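(* Let $n$ be a non-negative integer and let $\beta$ be a real number with $\beta\ge e^{n+1}-e^n$. If $p\in\mathcal{H}_1$ satisfies $$1+\beta\frac{zp'(z)}{p^{n+1}(z)}\prec e^z,$$ then $p(z)\prec e^z$.
   Context: $\mathbb{D}=\{z\in\mathbb{C}:|z|<1\}$. $\mathcal{H}_1$ is the class of analytic functions on $\mathbb{D}$ of the form $p(z)=1+a_1z+a_2z^2+\cdots$. $p^{k}(z)$ means $(p(z))^{k}$. For functions $F,G$ analytic in $\mathbb{D}$, $F\prec G$ (F is subordinate to G) means there is an analytic $w:\mathbb{D}\to\mathbb{C}$ with $w(0)=0$, $|w(z)|<1$ and $F(z)=G(w(z))$ for all $z\in\mathbb{D}$; writing $F\prec G$ presupposes that $F$ and $G$ are analytic in $\mathbb{D}$. *)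

theory Defs
  imports "HOL-Complex_Analysis.Complex_Analysis"
begin

abbreviation unit_disc :: "complex set" where
  "unit_disc \<equiv> ball 0 1"

text \<open>The class of analytic functions on the disc with Taylor expansion
  \<open>1 + a\<^sub>1 z + a\<^sub>2 z^2 + \<dots>\<close>; only the constant coefficient \<open>p 0\<close> is constrained.\<close>

definition H1 :: "(complex \<Rightarrow> complex) set" where
  "H1 = {p. p holomorphic_on unit_disc \<and> p 0 = 1}"

text \<open>Subordination is a relation between functions analytic on the disc, so analyticity of
  both sides is part of the definition. Values outside the disc are irrelevant.
  A pole of \<open>F\<close> in the disc is thereby excluded: the convention \<open>x / 0 = 0\<close> only changes the value
  at the pole, and \<open>F\<close> stays unbounded near it.\<close>

definition subordinate :: "(complex \<Rightarrow> complex) \<Rightarrow> (complex \<Rightarrow> complex) \<Rightarrow> bool"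
    (infix "\<prec>s" 50) where
  "F \<prec>s G \<longleftrightarrow>
     F holomorphic_on unit_disc \<and> G holomorphic_on unit_disc \<and>
     (\<exists>w. w holomorphic_on unit_disc \<and> w 0 = 0 \<and>
          (\<forall>z\<in>unit_disc. norm (w z) < 1 \<and> F z = G (w z)))"

end

theory Submission imports Defs
begin

text \<open>Let \<open>F\<close> be the function assumed to be subordinate to \<open>exp\<close>. The relation \<open>p' = g p^(n+1)\<close>, with \<open>g z = (F z - 1) / (\<beta> z)\<close> holomorphic, extends across the
  zeros of \<open>p\<close>; being a linear equation for \<open>p\<close> with coefficient \<open>g p^n\<close>, it yields \<open>p = exp q\<close>
  with \<open>q 0 = 0\<close>. If \<open>q\<close> left the unit disc, then by Jack's lemma there would be a point with
  \<open>|q z| = 1\<close> and \<open>|z q' z| \<ge> 1\<close>, hence \<open>|F z - 1| = \<beta> |z q' z| |exp (- n q z)| \<ge> \<beta> e^(-n) \<ge> e - 1\<close>,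
  whereas \<open>|exp w - 1| < e - 1\<close> for \<open>|w| < 1\<close>.\<close>

text \<open>The power series of \<open>exp w - 1\<close> has positive coefficients and no constant
  term, so the triangle inequality applies term by term.\<close>

lemma norm_exp_minus_one_le:
  fixes w :: "'a::{real_normed_field, banach}"
  shows "norm (exp w - 1) \<le> exp (norm w) - 1"
proof -
  \<comment> \<open>The separate type variable lets the series be used both for \<open>w\<close> and
    for the real number \<open>norm w\<close>.\<close>
  have tail: "exp x - 1 = (\<Sum>k. x ^ Suc k /\<^sub>R fact (Suc k))"
    "summable (\<lambda>k. x ^ Suc k /\<^sub>R fact (Suc k))" for x :: "'b::{real_normed_field, banach}"
  proof -
    have s: "summable (\<lambda>k. x ^ k /\<^sub>R fact k)" by (rule summable_exp_generic)
    show "exp x - 1 = (\<Sum>k. x ^ Suc k /\<^sub>R fact (Suc k))"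
      using suminf_split_head[OF s] by (simp add: exp_def)
    show "summable (\<lambda>k. x ^ Suc k /\<^sub>R fact (Suc k))"
      by (rule summable_Suc_iff[THEN iffD2, OF s])
  qed
  have "norm (\<Sum>k. w ^ Suc k /\<^sub>R fact (Suc k)) \<le> (\<Sum>k. norm w ^ Suc k /\<^sub>R fact (Suc k))"
    by (rule norm_suminf_le[OF _ tail(2)]) (simp add: norm_mult norm_power)
  then show ?thesis
    by (simp only: tail(1))
qed

text \<open>Take a point \<open>z\<close> of least modulus with \<open>norm (q z) \<ge> 1\<close>.
  Schwarz's lemma inside the circle through \<open>z\<close> bounds the growth of \<open>q\<close>
  along the radius, and the difference quotient at \<open>z\<close> inherits a lower bound.\<close>

lemma Jack_boundary_point:
  assumes holq: "q holomorphic_on ball 0 1" and q0: "q 0 = 0"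
    and z1: "z1 \<in> ball 0 1" "norm (q z1) \<ge> 1"
  obtains z where "z \<in> ball 0 1" "norm (q z) = 1" "norm (z * deriv q z) \<ge> 1"
proof -
  \<comment> \<open>The bound \<open>norm z1\<close> makes this set compact and loses nothing, since
    \<open>z1\<close> itself competes for the least modulus.\<close>
  define K where "K = {z \<in> cball 0 (norm z1). norm (q z) \<in> {1..}}"
  have sub: "cball 0 (norm z1) \<subseteq> ball (0::complex) 1"
    using z1 by auto
  have "continuous_on (cball 0 (norm z1)) (\<lambda>z. norm (q z))"
    using holomorphic_on_imp_continuous_on[OF holq] sub
    by (auto intro!: continuous_intros intro: continuous_on_subset)
  then have "closed ((\<lambda>z. norm (q z)) -` {1..} \<inter> cball 0 (norm z1))"
    by (rule continuous_on_closed_vimage[THEN iffD1, rule_format, rotated]) auto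
  moreover have "K = (\<lambda>z. norm (q z)) -` {1..} \<inter> cball 0 (norm z1)"
    by (auto simp: K_def)
  moreover have "bounded K"
    by (rule bounded_subset[OF bounded_cball[of 0 "norm z1"]]) (auto simp: K_def)
  ultimately have "compact K"
    by (simp add: compact_eq_bounded_closed)
  moreover have "z1 \<in> K"
    using z1 by (simp add: K_def)
  ultimately obtain z where zK: "z \<in> K" and zmin: "\<And>y. y \<in> K \<Longrightarrow> norm z \<le> norm y"
    using continuous_attains_inf[of K norm] by (auto intro: continuous_intros)
  have z: "z \<in> ball 0 1" "norm (q z) \<ge> 1" "norm z \<le> norm z1"
    using zK sub by (auto simp: K_def)
  have "z \<noteq> 0"
    using z q0 by auto
  have inner: "norm (q y) < 1" if "norm y < norm z" for y
    using zmin[of y] that z by (force simp: K_def)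
  \<comment> \<open>Rescaling moves \<open>z\<close> to 1. As \<open>z\<close> is interior to the
    disc, \<open>f\<close> is differentiable at 1 even though Schwarz's lemma only sees
    \<open>norm \<zeta> < 1\<close>.\<close>
  define f where "f \<zeta> = q (\<zeta> * z)" for \<zeta>
  have scale: "norm (\<zeta> * z) < norm z" if "norm \<zeta> < 1" for \<zeta>
    using that \<open>z \<noteq> 0\<close> by (simp add: norm_mult)
  have "f holomorphic_on ball 0 1"
    unfolding f_def using scale z(1)
    by (intro holomorphic_on_compose_gen[OF _ holq, unfolded o_def] holomorphic_intros) force
  then have Schwarz: "norm (f \<zeta>) \<le> norm \<zeta>" if "norm \<zeta> < 1" for \<zeta>
    using Schwarz_Lemma(1)[of f \<zeta>] inner scale q0 that by (simp add: f_def)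
  have "(q has_field_derivative deriv q z) (at (1 * z))"
    using holomorphic_derivI[OF holq _ z(1)] by simp
  then have fderiv: "(f has_field_derivative z * deriv q z) (at 1)"
    unfolding f_def
    using DERIV_chain2[of q "deriv q z" "\<lambda>\<zeta>. \<zeta> * z" 1 z UNIV] DERIV_cmult_right[OF DERIV_ident, of z]
    by (simp add: mult.commute)
  have lim1: "filterlim complex_of_real (at 1) (at_left 1)"
    by (rule filterlim_atI) (auto intro!: tendsto_eq_intros simp: eventually_at_filter)
  have near: "\<forall>\<^sub>F t in at_left (1::real). t \<in> {0<..<1}"
    using eventually_at_left_real[of 0 "1::real"] by simp
  have "((\<lambda>t. norm (f (of_real t))) \<longlongrightarrow> norm (f 1)) (at_left 1)"
    using filterlim_compose[OF DERIV_isCont[OF fderiv, unfolded isCont_def] lim1]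
    by (rule tendsto_norm)
  moreover have "\<forall>\<^sub>F t in at_left 1. norm (f (of_real t)) \<le> 1"
    using near by eventually_elim (rule order_trans[OF Schwarz], auto)
  ultimately have "norm (f 1) \<le> 1"
    by (rule tendsto_upperbound) simp
  then have q1: "norm (q z) = 1"
    using z(2) by (simp add: f_def)
  have "((\<lambda>t. norm ((f (of_real t) - f 1) / (of_real t - 1))) \<longlongrightarrow> norm (z * deriv q z)) (at_left 1)"
    using filterlim_compose[OF fderiv[unfolded has_field_derivative_iff] lim1]
    by (rule tendsto_norm)
  \<comment> \<open>Here \<open>norm (f 1) = 1\<close> and \<open>norm (f t) \<le> t\<close>, so the
    numerator has norm at least \<open>1 - t\<close>.\<close>
  moreover have "\<forall>\<^sub>F t in at_left 1. 1 \<le> norm ((f (of_real t) - f 1) / (of_real t - 1))"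
    using near
  proof eventually_elim
    case (elim t)
    have "norm (complex_of_real t - 1) = 1 - t"
      using elim norm_of_real[of "t - 1", where 'a = complex] by simp
    moreover have "norm (f (of_real t)) \<le> t"
      using Schwarz[of "of_real t"] elim by simp
    moreover have "norm (f 1) - norm (f (of_real t)) \<le> norm (f (of_real t) - f 1)"
      by (metis norm_minus_commute norm_triangle_ineq2)
    ultimately show ?case
      using elim q1 by (simp add: f_def norm_divide)
  qed
  ultimately have "1 \<le> norm (z * deriv q z)"
    by (rule tendsto_lowerbound) simp
  with z(1) q1 show thesis
    by (rule that)
qed

text \<open>Convexity provides a primitive \<open>q\<close> of \<open>h\<close> with
  \<open>q a = 0\<close>; then \<open>f * exp (- q)\<close> has derivative 0 and equals 1 at
  \<open>a\<close>.\<close>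

lemma linear_ode_imp_exp:
  fixes f h :: "complex \<Rightarrow> complex"
  assumes S: "convex S" "open S" "a \<in> S" and holh: "h holomorphic_on S"
    and f: "\<And>z. z \<in> S \<Longrightarrow> (f has_field_derivative h z * f z) (at z)" "f a = 1"
  obtains q where "q a = 0" "\<And>z. z \<in> S \<Longrightarrow> (q has_field_derivative h z) (at z)"
    "\<And>z. z \<in> S \<Longrightarrow> f z = exp (q z)"
proof -
  obtain H where H: "\<And>z. z \<in> S \<Longrightarrow> (H has_field_derivative h z) (at z within S)"
    using holomorphic_convex_primitive'[OF S(1,2) holh] by blast
  define q where "q z = H z - H a" for z
  have q: "(q has_field_derivative h z) (at z)" if "z \<in> S" for z
    unfolding q_def using H[OF that, unfolded at_within_open[OF that S(2)]]
    by (auto intro!: derivative_eq_intros)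
  have "((\<lambda>z. f z * exp (- q z)) has_field_derivative 0) (at z within S)" if "z \<in> S" for z
  proof -
    have "((\<lambda>z. exp (- q z)) has_field_derivative exp (- q z) * - h z) (at z)"
      by (rule DERIV_chain2[of exp _ "\<lambda>z. - q z"]) (rule DERIV_exp DERIV_minus q that)+
    from DERIV_mult[OF f(1)[OF that] this]
    have "((\<lambda>z. f z * exp (- q z)) has_field_derivative 0) (at z)"
      by simp
    then show ?thesis
      by (rule has_field_derivative_at_within)
  qed
  then have "\<exists>c. \<forall>z\<in>S. f z * exp (- q z) = c"
    by (rule has_field_derivative_zero_constant[OF S(1)])
  then obtain c where c: "\<And>z. z \<in> S \<Longrightarrow> f z * exp (- q z) = c"
    by blast
  have "c = 1"
    using c[OF S(3)] f(2) by (simp add: q_def)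
  then have "f z = exp (q z)" if "z \<in> S" for z
    using c[OF that] by (simp add: exp_minus field_simps)
  with q show thesis
    using that[of q] by (simp add: q_def)
qed

theorem theorem4p2:
  fixes n :: nat and \<beta> :: real and p :: "complex \<Rightarrow> complex"
  assumes "\<beta> \<ge> exp (real (n + 1)) - exp (real n)"
    and "p \<in> H1"
    and "(\<lambda>z. 1 + complex_of_real \<beta> * (z * deriv p z / p z ^ (n + 1))) \<prec>s exp"
  shows "p \<prec>s exp"
proof -
  define F where "F z = 1 + complex_of_real \<beta> * (z * deriv p z / p z ^ (n + 1))" for z
  have holp: "p holomorphic_on unit_disc" and p0: "p 0 = 1"
    using assms(2) by (auto simp: H1_def)
  obtain w where holF: "F holomorphic_on unit_disc"
    and w: "\<And>z. z \<in> unit_disc \<Longrightarrow> norm (w z) < 1" "\<And>z. z \<in> unit_disc \<Longrightarrow> F z = exp (w z)"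
    using assms(3) unfolding subordinate_def F_def[symmetric] by blast
  have \<beta>: "\<beta> \<ge> (exp 1 - 1) * exp (real n)"
    using assms(1) by (simp add: exp_add algebra_simps)
  moreover have "(exp 1 - 1 :: real) > 0"
    by simp
  ultimately have "\<beta> > 0"
    by (smt (verit) exp_gt_zero mult_pos_pos)
  \<comment> \<open>The zero of \<open>F - 1\<close> at the origin is divided out.\<close>
  obtain g where holg: "g holomorphic_on unit_disc"
    and g: "\<And>z. norm z < 1 \<Longrightarrow> (F z - 1) / of_real \<beta> = z * g z"
  proof (rule Schwarz3)
    show "(\<lambda>z. (F z - 1) / of_real \<beta>) holomorphic_on unit_disc"
      using \<open>\<beta> > 0\<close> by (intro holomorphic_intros holF) simp
    show "(F 0 - 1) / of_real \<beta> = 0"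
      by (simp add: F_def)
  qed blast
  define h where "h z = g z * p z ^ n" for z
  have holh: "h holomorphic_on unit_disc"
    unfolding h_def by (intro holomorphic_intros holg holp)
  obtain e where "e > 0" and e: "\<And>z. z \<in> ball 0 e \<Longrightarrow> z \<in> unit_disc \<and> p z \<noteq> 0"
  proof -
    obtain e where "e > 0" "\<And>z. dist 0 z < e \<Longrightarrow> p z \<noteq> 0"
      using continuous_on_open_avoid[OF holomorphic_on_imp_continuous_on[OF holp], of 0 0] p0 by auto
    then show thesis
      using that[of "min e 1"] by simp
  qed
  have "deriv p z = h z * p z" if "z \<in> unit_disc" for z
  \<comment> \<open>Near 0, \<open>p\<close> has no zeros, so the quotient in \<open>F\<close> is a
    true one; the origin is removed in order to cancel \<open>z\<close>. The identity theorem then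
    reaches the whole disc, including any zero of \<open>p\<close>.\<close>
  proof (rule analytic_continuation_open[of "ball 0 e - {0}" unit_disc "deriv p"])
    show "ball 0 e - {0::complex} \<noteq> {}"
      using not_open_singleton[of "0::complex"] open_ball[of "0::complex" e] \<open>e > 0\<close>
      by (metis Diff_eq_empty_iff centre_in_ball empty_iff subset_singleton_iff)
    show "deriv p z = h z * p z" if "z \<in> ball 0 e - {0}" for z
    proof -
      have "z * deriv p z / p z ^ (n + 1) = z * g z"
        using g[of z] e[of z] that \<open>\<beta> > 0\<close> by (simp add: F_def)
      then show ?thesis
        using e[of z] that by (simp add: h_def field_simps)
    qed
  qed (use e holp holh that in \<open>auto intro!: holomorphic_intros\<close>)
  then have "(p has_field_derivative h z * p z) (at z)" if "z \<in> unit_disc" for z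
    using holomorphic_derivI[OF holp open_ball that] that by metis
  then obtain q where q: "q 0 = 0" "\<And>z. z \<in> unit_disc \<Longrightarrow> (q has_field_derivative h z) (at z)"
    "\<And>z. z \<in> unit_disc \<Longrightarrow> p z = exp (q z)"
    using linear_ode_imp_exp[of unit_disc 0 h p] holh p0 by auto
  have holq: "q holomorphic_on unit_disc"
    using q(2) holomorphic_on_open[OF open_ball] by metis
  have "norm (q z) < 1" if z: "z \<in> unit_disc" for z
  proof (rule ccontr)
    assume "\<not> norm (q z) < 1"
    then obtain y where y: "y \<in> unit_disc" "norm (q y) = 1" "norm (y * deriv q y) \<ge> 1"
      using Jack_boundary_point[OF holq q(1) z] by force
    \<comment> \<open>Here \<open>deriv q y = g y * p y ^ n\<close>, and the power of
      \<open>p = exp q\<close> becomes \<open>exp (n * q y)\<close>.\<close>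
    have "y * deriv q y = (F y - 1) / of_real \<beta> * exp (of_nat n * q y)"
      using y(1) g[of y] q(2,3)[OF y(1)] by (simp add: DERIV_imp_deriv h_def exp_of_nat_mult)
    then have "norm (y * deriv q y) = norm (F y - 1) / \<beta> * exp (real n * Re (q y))"
      using \<open>\<beta> > 0\<close> by (simp add: norm_mult norm_divide)
    also have "\<dots> \<le> norm (F y - 1) / \<beta> * exp (real n)"
      using \<open>\<beta> > 0\<close> complex_Re_le_cmod[of "q y"] y(2)
      by (intro mult_left_mono) (auto simp: mult_left_le)
    \<comment> \<open>Strict because \<open>norm (w y) < 1\<close>.\<close>
    also have "\<dots> < (exp 1 - 1) / \<beta> * exp (real n)"
      using \<open>\<beta> > 0\<close> norm_exp_minus_one_le[of "w y"] w[OF y(1)]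
      by (intro mult_strict_right_mono divide_strict_right_mono) (auto intro: le_less_trans)
    also have "\<dots> \<le> 1"
      using \<beta> \<open>\<beta> > 0\<close> by (simp add: field_simps)
    finally show False
      using y(3) by simp
  qed
  \<comment> \<open>The logarithm \<open>q\<close> is itself the function required by the
    subordination.\<close>
  then show ?thesis
    unfolding subordinate_def using holp holq q by (auto intro: holomorphic_intros)
qed

end
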